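(* Let $A=\{a_1,\ldots,a_d\}$ with $a_1<\cdots<a_d$ positive integers. Then $$C_{peak}^A(x,y,z)=\frac{1+\sum_{j\ge 1}M^{2j}(A) (1-y)^j}{1+\sum_{j\ge 1}M^{2j}(A) (1-y)^j-\sum_{j\ge 0}M^{2j+1}(A) (1-y)^{j}}$$ and $$C_{valley}^A(x,y,z)=\frac{1+\sum_{j\ge 1}M^{2j}(A) (1-y)^{j}}{1+\sum_{j\ge 1}M^{2j}(A)(1-y)^{j}-\sum_{j\ge 0}N^{2j+1}(A) (1-y)^{j}}.$$
   Context: A composition with parts in $A$ is a finite sequence $\sigma=\sigma_1\cdots\sigma_m$ ($m\ge0$, empty included) of elements of $A$; $n(\sigma)$ is the sum of parts and $m(\sigma)=m$. A peak of $\sigma$ is an index $i$, $1\le i\le m-2$, with $\sigma_i<\sigma_{i+1}>\sigma_{i+2}$ (i.e. an occurrence of one of the patterns $121,132,231$); a valley is an index $i$ with $\sigma_i>\sigma_{i+1}<\sigma_{i+2}$ (an occurrence of $212,213,312$). $C_{peak}^A(x,y,z)=\sum_\sigma x^{n(\sigma)}y^{\#\text{peaks}(\sigma)}z^{m(\sigma)}$ and $C_{valley}^A(x,y,z)=\sum_\sigma x^{n(\sigma)}y^{\#\text{valleys}(\sigma)}z^{m(\sigma)}$, summing over all compositions with parts in $A$. For $s\ge1$: $P^s(A)$ is the set of tuples $(i_1,\ldots,i_s)\in\{1,\ldots,d\}^s$ such that $i_{2\ell-1}<i_{2\ell}$ and $i_{2\ell}\le i_{2\ell+1}$ for all $\ell\ge1$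 for which the indices involved are at most $s$; $Q^s(A)$ is the set of tuples $(i_1,\ldots,i_s)\in\{1,\ldots,d\}^s$ such that $i_{2\ell-1}\le i_{2\ell}$ and $i_{2\ell}< i_{2\ell+1}$ for all such $\ell$. Then $M^s(A)=\sum_{(i_1,\ldots,i_s)\in P^s(A)} z^{s}\prod_{j=1}^s x^{a_{i_j}}$ and $N^s(A)=\sum_{(i_1,\ldots,i_s)\in Q^s(A)} z^{s}\prod_{j=1}^s x^{a_{i_j}}$. *)

theory Defs
  imports
    "HOL-Computational_Algebra.Formal_Power_Series"
    "HOL-Library.FuncSet"
begin

unbundle fps_syntax

text \<open>
  Formal power series in \<open>x, y, z\<close> over the rationals are modelled by iterating the
  univariate type: the coefficient of \<open>x^n y^k z^m\<close> in \<open>F\<close> is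
  \<open>F $ m $ n $ k\<close>. The topology used for infinite sums is the \<open>z\<close>-adic one.
\<close>

type_synonym gf = "rat fps fps fps"

definition gf_z :: gf where
  "gf_z = fps_X"

definition gf_x :: gf where
  "gf_x = fps_const fps_X"

definition gf_y :: gf where
  "gf_y = fps_const (fps_const fps_X)"

definition compositions :: "nat set \<Rightarrow> nat list set" where
  "compositions A = lists A"

text \<open>List positions are counted from 0.\<close>

definition peaks :: "nat list \<Rightarrow> nat" where
  "peaks \<sigma> = card {i. i + 2 < length \<sigma> \<and> \<sigma> ! i < \<sigma> ! (i + 1) \<and> \<sigma> ! (i + 1) > \<sigma> ! (i + 2)}"

definition valleys :: "nat list \<Rightarrow> nat" where
  "valleys \<sigma> = card {i. i + 2 < length \<sigma> \<and> \<sigma> ! i > \<sigma> ! (i + 1) \<and> \<sigma> ! (i + 1) < \<sigma> ! (i + 2)}"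

text \<open>
  The sum of \<open>x^n y^(stat \<sigma>) z^m\<close> over all compositions with parts in \<open>A\<close>, given by its
  coefficients. For finite \<open>A\<close> all the sets counted are finite, see
  \<open>finite_compositions_length\<close>; the sum over compositions of fixed length is then
  \<open>composition_gf_nth\<close>.
\<close>

definition composition_gf :: "nat set \<Rightarrow> (nat list \<Rightarrow> nat) \<Rightarrow> gf" where
  "composition_gf A stat =
     Abs_fps (\<lambda>m. Abs_fps (\<lambda>n. Abs_fps (\<lambda>k.
       of_nat (card {\<sigma> \<in> compositions A. sum_list \<sigma> = n \<and> stat \<sigma> = k \<and> length \<sigma> = m}))))"

definition C_peak :: "nat set \<Rightarrow> gf" where
  "C_peak A = composition_gf A peaks"

definition C_valley :: "nat set \<Rightarrow> gf" where
  "C_valley A = composition_gf A valleys"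

text \<open>Index tuples \<open>(i\<^sub>1, \<dots>, i\<^sub>s)\<close> are extensional functions on \<open>{1..s}\<close>.\<close>

definition P_tuples :: "nat \<Rightarrow> nat \<Rightarrow> (nat \<Rightarrow> nat) set" where
  "P_tuples d s = {i \<in> {1..s} \<rightarrow>\<^sub>E {1..d}.
     (\<forall>l\<ge>1. 2 * l \<le> s \<longrightarrow> i (2 * l - 1) < i (2 * l)) \<and>
     (\<forall>l\<ge>1. 2 * l + 1 \<le> s \<longrightarrow> i (2 * l) \<le> i (2 * l + 1))}"

definition Q_tuples :: "nat \<Rightarrow> nat \<Rightarrow> (nat \<Rightarrow> nat) set" where
  "Q_tuples d s = {i \<in> {1..s} \<rightarrow>\<^sub>E {1..d}.
     (\<forall>l\<ge>1. 2 * l \<le> s \<longrightarrow> i (2 * l - 1) \<le> i (2 * l)) \<and>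
     (\<forall>l\<ge>1. 2 * l + 1 \<le> s \<longrightarrow> i (2 * l) < i (2 * l + 1))}"

definition M_sum :: "(nat \<Rightarrow> nat) \<Rightarrow> nat \<Rightarrow> nat \<Rightarrow> gf" where
  "M_sum a d s = (\<Sum>i\<in>P_tuples d s. gf_z ^ s * (\<Prod>j=1..s. gf_x ^ a (i j)))"

definition N_sum :: "(nat \<Rightarrow> nat) \<Rightarrow> nat \<Rightarrow> nat \<Rightarrow> gf" where
  "N_sum a d s = (\<Sum>i\<in>Q_tuples d s. gf_z ^ s * (\<Prod>j=1..s. gf_x ^ a (i j)))"

lemma finite_compositions_length:
  assumes "finite A"
  shows "finite {\<sigma> \<in> compositions A. length \<sigma> = m}"
proof -
  have "{\<sigma> \<in> compositions A. length \<sigma> = m} = {\<sigma>. set \<sigma> \<subseteq> A \<and> length \<sigma> = m}"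
    by (auto simp: compositions_def)
  then show ?thesis
    using finite_lists_length_eq[OF assms] by simp
qed

lemma composition_gf_nth:
  assumes "finite A"
  shows "composition_gf A stat $ m =
    (\<Sum>\<sigma> | \<sigma> \<in> compositions A \<and> length \<sigma> = m. fps_X ^ sum_list \<sigma> * fps_const (fps_X ^ stat \<sigma>))"
proof (intro fps_ext)
  fix n k
  let ?S = "{\<sigma>. \<sigma> \<in> compositions A \<and> length \<sigma> = m}"
  let ?T = "{\<sigma> \<in> compositions A. sum_list \<sigma> = n \<and> stat \<sigma> = k \<and> length \<sigma> = m}"
  have fin: "finite ?S"
    using finite_compositions_length[OF assms] by simp
  have "(\<Sum>\<sigma>\<in>?S. fps_X ^ sum_list \<sigma> * fps_const (fps_X ^ stat \<sigma>)) $ n $ k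
      = (\<Sum>\<sigma>\<in>?S. if sum_list \<sigma> = n \<and> stat \<sigma> = k then 1 else (0::rat))"
    unfolding fps_sum_nth
    by (rule sum.cong) (auto simp: fps_mult_right_const_nth fps_X_power_nth)
  also have "\<dots> = of_nat (card (?S \<inter> {\<sigma>. sum_list \<sigma> = n \<and> stat \<sigma> = k}))"
    using fin by (simp add: sum.If_cases)
  also have "?S \<inter> {\<sigma>. sum_list \<sigma> = n \<and> stat \<sigma> = k} = ?T"
    by auto
  finally show "composition_gf A stat $ m $ n $ k
      = (\<Sum>\<sigma>\<in>?S. fps_X ^ sum_list \<sigma> * fps_const (fps_X ^ stat \<sigma>)) $ n $ k"
    by (simp add: composition_gf_def)
qed

text \<open>
  The coefficient ring \<open>rat fps fps\<close> is not a field, but for a denominator with constant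
  term 1 (in \<open>z\<close>) the library's division is the true quotient.
\<close>

lemma gf_divide_eq_iff:
  fixes F G H :: gf
  assumes "G $ 0 = 1"
  shows "F = H / G \<longleftrightarrow> F * G = H"
proof -
  have inv1: "inverse (1 :: rat fps fps) = 1"
    by (rule fps_inverse_one'[OF fps_inverse_one'[OF inverse_1]])
  have "G $ 0 * inverse (G $ 0) = 1"
    unfolding assms inv1 by simp
  then have GI: "G * inverse G = 1"
    unfolding fps_inverse_def by (rule fps_right_inverse)
  have HG: "H / G = H * inverse G"
    by (rule fps_divide_unit) (simp only: assms one_neq_zero not_False_eq_True)
  show ?thesis
  proof
    assume "F = H / G"
    then have "F * G = H * (G * inverse G)"
      by (simp only: HG mult_ac)
    then show "F * G = H"
      by (simp only: GI mult_1_right)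
  next
    assume "F * G = H"
    then have "H / G = F * (G * inverse G)"
      unfolding HG by (simp only: mult.assoc[symmetric])
    then show "F = H / G"
      by (simp only: GI mult_1_right)
  qed
qed

end

theory Submission
  imports Defs "HOL-Computational_Algebra.Formal_Laurent_Series"
begin

text \<open>
  Writing \<open>y = 1 + (y - 1)\<close> for every peak amounts to marking some of the peaks, and a maximal
  run of overlapping marked peaks is a word \<open>\<sigma>\<^sub>1 < \<sigma>\<^sub>2 > \<sigma>\<^sub>3 < \<dots> > \<sigma>\<^sub>2\<^sub>k\<^sub>+\<^sub>1\<close>. If \<open>K\<close> enumerates
  these clusters with weight \<open>(y - 1)^k\<close>, then \<open>C = 1 + K C\<close>. Clusters are in turn
  related to chains \<open>\<sigma>\<^sub>1 < \<sigma>\<^sub>2 \<le> \<sigma>\<^sub>3 < \<dots>\<close>: a chain of even length followed by a cluster leaves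
  the junction free, so that in the alternating sum over the length of the chain everything
  cancels but the chains of odd length. Hence \<open>E K = O\<close> for the even and odd chain sums, and
  \<open>C (E - O) = E C (1 - K) = E\<close>. For valleys the cluster \<open>\<sigma>\<^sub>1 > \<sigma>\<^sub>2 < \<dots>\<close> comes first and is
  followed by the even chain, which leaves the odd chains \<open>\<sigma>\<^sub>1 \<le> \<sigma>\<^sub>2 < \<sigma>\<^sub>3 \<le> \<dots>\<close>.
\<close>

section \<open>Alternating words and the number of extrema\<close>

fun alternating :: "('a \<Rightarrow> 'a \<Rightarrow> bool) \<Rightarrow> ('a \<Rightarrow> 'a \<Rightarrow> bool) \<Rightarrow> 'a list \<Rightarrow> bool" where
  "alternating P Q (x # y # zs) \<longleftrightarrow> P x y \<and> alternating Q P (y # zs)"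
| "alternating P Q _ \<longleftrightarrow> True"

lemma alternating_iff_nth:
  "alternating P Q xs \<longleftrightarrow>
    (\<forall>i. Suc i < length xs \<longrightarrow> (if even i then P else Q) (xs ! i) (xs ! Suc i))"
proof (induction P Q xs rule: alternating.induct)
  case (1 P Q x y zs)
  show ?case
    unfolding alternating.simps 1
    by (auto simp: nth_Cons less_Suc_eq_0_disj split: nat.split)
qed auto

text \<open>Dropping two letters restores the roles of the two relations in
  \<open>alternating\<close> and keeps the parity of the length, so the hypothesis must reach
  \<open>z # zs\<close>.\<close>

lemma list_step2_induct [case_names Nil single pair triple]:
  assumes "R []" "\<And>x. R [x]" "\<And>x y. R [x, y]"
    "\<And>x y z zs. R (z # zs) \<Longrightarrow> R (y # z # zs) \<Longrightarrow> R (x # y # z # zs)"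
  shows "R xs"
proof (induction xs rule: length_induct)
  case (1 xs)
  then show ?case
    using assms by (cases xs rule: remdups_adj.cases; (cases "tl (tl xs)")?) auto
qed

text \<open>The common form of both statistics: \<open>(<)\<close>, \<open>(>)\<close> count peaks,
  \<open>(>)\<close>, \<open>(<)\<close> count valleys.\<close>

definition extrema :: "('a \<Rightarrow> 'a \<Rightarrow> bool) \<Rightarrow> ('a \<Rightarrow> 'a \<Rightarrow> bool) \<Rightarrow> 'a list \<Rightarrow> nat" where
  "extrema P Q \<sigma> = card {i. i + 2 < length \<sigma> \<and>
     P (\<sigma> ! i) (\<sigma> ! (i + 1)) \<and> Q (\<sigma> ! (i + 1)) (\<sigma> ! (i + 2))}"

lemma extrema_short: "length \<sigma> < 3 \<Longrightarrow> extrema P Q \<sigma> = 0"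
  by (simp add: extrema_def)

lemma extrema_Cons:
  "extrema P Q (x # y # z # zs) = of_bool (P x y \<and> Q y z) + extrema P Q (y # z # zs)"
proof -
  let ?S = "\<lambda>\<sigma>. {i. i + 2 < length \<sigma> \<and> P (\<sigma> ! i) (\<sigma> ! (i + 1)) \<and> Q (\<sigma> ! (i + 1)) (\<sigma> ! (i + 2))}"
  have "?S (x # y # z # zs) = (if P x y \<and> Q y z then {0} else {}) \<union> Suc ` ?S (y # z # zs)"
  proof (rule set_eqI)
    fix i show "i \<in> ?S (x # y # z # zs) \<longleftrightarrow>
      i \<in> (if P x y \<and> Q y z then {0} else {}) \<union> Suc ` ?S (y # z # zs)"
      by (cases i) auto
  qed
  moreover have "finite (?S (y # z # zs))"
    by (rule finite_subset[of _ "{..<length (y # z # zs)}"]) auto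
  ultimately show ?thesis
    unfolding extrema_def by (simp add: card_insert_if card_image)
qed

section \<open>Marking and cancellation in a single word\<close>

text \<open>
  The hypothesis keeps two consecutive positions from both being extrema, so the marked extrema
  of a cluster overlap in exactly one letter.
\<close>

lemma cluster_expansion:
  fixes q :: "'b::comm_ring_1"
  assumes PQ: "\<And>x y. P x y \<Longrightarrow> \<not> Q x y" and "\<sigma> \<noteq> []"
  shows "q ^ extrema P Q \<sigma> =
    (\<Sum>k<(length \<sigma> + 1) div 2. (q - 1) ^ k *
      (of_bool (alternating P Q (take (2 * k + 1) \<sigma>)) * q ^ extrema P Q (drop (2 * k + 1) \<sigma>)))"
  using \<open>\<sigma> \<noteq> []\<close>
proof (induction \<sigma> rule: list_step2_induct)
  case (triple x y z zs)
  let ?F = "\<lambda>\<sigma> k. (q - 1) ^ k *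
      (of_bool (alternating P Q (take (2 * k + 1) \<sigma>)) * q ^ extrema P Q (drop (2 * k + 1) \<sigma>))"
  have F_Suc: "?F (x # y # z # zs) (Suc k) = of_bool (P x y \<and> Q y z) * (q - 1) * ?F (z # zs) k" for k
    by simp
  have eq: "extrema P Q (y # z # zs) = extrema P Q (z # zs)" if "Q y z"
    using that PQ by (cases zs) (auto simp: extrema_Cons extrema_short)
  have "(\<Sum>k<(length (x # y # z # zs) + 1) div 2. ?F (x # y # z # zs) k)
      = q ^ extrema P Q (y # z # zs) + (\<Sum>k<(length (z # zs) + 1) div 2. ?F (x # y # z # zs) (Suc k))"
    by (simp add: sum.lessThan_Suc_shift del: sum.lessThan_Suc)
  also have "\<dots> = q ^ extrema P Q (y # z # zs)
      + of_bool (P x y \<and> Q y z) * (q - 1) * q ^ extrema P Q (z # zs)"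
    unfolding F_Suc sum_distrib_left[symmetric] using triple.IH(1) by simp
  also have "\<dots> = q ^ extrema P Q (x # y # z # zs)"
  \<comment> \<open>At an extremum the summands 1 (unmarked) and \<open>q - 1\<close> (marked)
    multiply the same power, by \<open>eq\<close>, and add up to the factor
    \<open>q\<close>.\<close>
  proof (cases "P x y \<and> Q y z")
    case True
    then show ?thesis by (simp add: extrema_Cons[of P Q x] eq algebra_simps)
  next
    case False
    then have 0: "of_bool (P x y \<and> Q y z) = (0 :: 'b)" "of_bool (P x y \<and> Q y z) = (0 :: nat)"
      by auto
    show ?thesis
      unfolding extrema_Cons[of P Q x] 0 by simp
  qed
  finally show ?case by simp
qed (auto simp: extrema_short)

text \<open>The step joining cluster and chain is free. Let \<open>b_k\<close> indicate that all
  \<open>Q\<close> steps hold and that of the other steps the first \<open>k\<close> satisfy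
  \<open>P\<close> and the rest violate it. The terms are \<open>(-1)^k (b_k + b_(k+1))\<close> for
  \<open>k < j\<close> and finally \<open>(-1)^j b_j\<close>, so the sum telescopes to
  \<open>b_0\<close>.\<close>

lemma cluster_then_chain:
  assumes "length \<sigma> = 2 * j + 1"
  shows "(\<Sum>k\<le>j. (- 1) ^ k * (of_bool (alternating P Q (take (2 * k + 1) \<sigma>)) *
      of_bool (alternating Q (\<lambda>x y. \<not> P x y) (drop (2 * k + 1) \<sigma>)))) =
    (of_bool (alternating (\<lambda>x y. \<not> P x y) Q \<sigma>) :: 'b::comm_ring_1)"
  using assms
proof (induction \<sigma> arbitrary: j rule: list_step2_induct)
  case (triple x y z zs)
  then obtain i where j: "j = Suc i" and len: "length (z # zs) = 2 * i + 1"
    by (cases j) auto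
  let ?F = "\<lambda>\<sigma> k. (- 1) ^ k * (of_bool (alternating P Q (take (2 * k + 1) \<sigma>)) *
      of_bool (alternating Q (\<lambda>x y. \<not> P x y) (drop (2 * k + 1) \<sigma>))) :: 'b"
  have F_Suc: "?F (x # y # z # zs) (Suc k) = - of_bool (P x y \<and> Q y z) * ?F (z # zs) k" for k
    by simp
  have "(\<Sum>k\<le>j. ?F (x # y # z # zs) k)
      = ?F (x # y # z # zs) 0 - of_bool (P x y \<and> Q y z) * (\<Sum>k\<le>i. ?F (z # zs) k)"
    unfolding j sum.atMost_Suc_shift F_Suc sum_distrib_left[symmetric] by simp
  also have "\<dots> = of_bool (alternating (\<lambda>x y. \<not> P x y) Q (x # y # z # zs))"
    unfolding triple.IH(1)[OF len] by auto
  finally show ?case .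
qed auto

text \<open>Telescoping from the other end: all \<open>P\<close> steps hold, and \<open>b_k\<close>
  says that the first \<open>k\<close> of the other steps violate \<open>Q\<close> and the rest
  satisfy it. The terms are \<open>b_0\<close> and then \<open>(-1)^k (b_(k-1) + b_k)\<close>, which
  leaves \<open>(-1)^j b_j\<close>.\<close>

lemma chain_then_cluster:
  assumes "length \<sigma> = 2 * j + 1"
  shows "(\<Sum>k\<le>j. (- 1) ^ k * (of_bool (alternating P (\<lambda>x y. \<not> Q x y) (take (2 * k) \<sigma>)) *
      of_bool (alternating P Q (drop (2 * k) \<sigma>)))) =
    ((- 1) ^ j * of_bool (alternating P (\<lambda>x y. \<not> Q x y) \<sigma>) :: 'b::comm_ring_1)"
  using assms
proof (induction \<sigma> arbitrary: j rule: list_step2_induct)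
  case (triple x y z zs)
  then obtain i where j: "j = Suc i" and len: "length (z # zs) = 2 * i + 1"
    by (cases j) auto
  let ?R = "\<lambda>x y. \<not> Q x y"
  let ?F = "\<lambda>\<sigma> k. (- 1) ^ k * (of_bool (alternating P ?R (take (2 * k) \<sigma>)) *
      of_bool (alternating P Q (drop (2 * k) \<sigma>))) :: 'b"
  have F0: "?F (x # y # z # zs) 0 = of_bool (P x y \<and> Q y z) * ?F (z # zs) 0"
    by auto
  \<comment> \<open>For \<open>k = 0\<close> the chain is \<open>[x, y]\<close> and the step from
    \<open>y\<close> to \<open>z\<close> is free; the extra term is its case \<open>Q y z\<close>,
    which cancels \<open>F0\<close>.\<close>
  have F_Suc: "?F (x # y # z # zs) (Suc k)
      = - of_bool (P x y \<and> ?R y z) * ?F (z # zs) k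
        - (if k = 0 then of_bool (P x y \<and> Q y z) * ?F (z # zs) 0 else 0)" for k
    by (cases k) auto
  have "(\<Sum>k\<le>j. ?F (x # y # z # zs) k)
      = ?F (x # y # z # zs) 0 - of_bool (P x y \<and> ?R y z) * (\<Sum>k\<le>i. ?F (z # zs) k)
        - of_bool (P x y \<and> Q y z) * ?F (z # zs) 0"
    unfolding j sum.atMost_Suc_shift F_Suc sum_subtractf sum_distrib_left[symmetric]
    by simp
  also have "\<dots> = (- 1) ^ j * of_bool (alternating P ?R (x # y # z # zs))"
    unfolding triple.IH(1)[OF len] F0 j by auto
  finally show ?case .
qed auto

section \<open>Weighted sums over words of fixed length\<close>

text \<open>The coefficient of \<open>z^n\<close> in a sum over words: here \<open>fps_X\<close>
  stands for \<open>x\<close>, while \<open>y\<close> lives in \<open>'b\<close>.\<close>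

definition word_sum :: "nat set \<Rightarrow> nat \<Rightarrow> (nat list \<Rightarrow> 'b fps) \<Rightarrow> 'b::comm_ring_1 fps" where
  "word_sum A n f = (\<Sum>\<sigma> | set \<sigma> \<subseteq> A \<and> length \<sigma> = n. fps_X ^ sum_list \<sigma> * f \<sigma>)"

lemma word_sum_cong:
  "(\<And>\<sigma>. length \<sigma> = n \<Longrightarrow> f \<sigma> = g \<sigma>) \<Longrightarrow> word_sum A n f = word_sum A n g"
  unfolding word_sum_def by (rule sum.cong) auto

lemma word_sum_0: "word_sum A 0 f = f []"
proof -
  have "{\<sigma>. set \<sigma> \<subseteq> A \<and> length \<sigma> = 0} = {[]}" by auto
  then show ?thesis by (simp add: word_sum_def)
qed

lemma word_sum_sum:
  "(\<Sum>k\<in>K. c k * word_sum A n (f k)) = word_sum A n (\<lambda>\<sigma>. \<Sum>k\<in>K. c k * f k \<sigma>)"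
  unfolding word_sum_def sum_distrib_left by (subst sum.swap) (simp add: mult_ac)

lemma word_sum_mult_left: "c * word_sum A n f = word_sum A n (\<lambda>\<sigma>. c * f \<sigma>)"
  unfolding word_sum_def sum_distrib_left by (simp add: mult_ac)

lemma word_sum_mult:
  "word_sum A p f * word_sum A q g = word_sum A (p + q) (\<lambda>\<sigma>. f (take p \<sigma>) * g (drop p \<sigma>))"
proof -
  let ?W = "\<lambda>n. {\<sigma>. set \<sigma> \<subseteq> A \<and> length \<sigma> = n}"
  have "word_sum A p f * word_sum A q g
      = (\<Sum>(u, v)\<in>?W p \<times> ?W q. fps_X ^ sum_list u * f u * (fps_X ^ sum_list v * g v))"
    unfolding word_sum_def sum_product sum.cartesian_product ..
  also have "\<dots> = word_sum A (p + q) (\<lambda>\<sigma>. f (take p \<sigma>) * g (drop p \<sigma>))"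
    unfolding word_sum_def
    by (rule sum.reindex_bij_witness[of _ "\<lambda>\<sigma>. (take p \<sigma>, drop p \<sigma>)" "\<lambda>(u, v). u @ v"])
      (auto simp: power_add mult_ac dest: in_set_takeD in_set_dropD)
  finally show ?thesis .
qed

definition chain_sum :: "nat set \<Rightarrow> (nat \<Rightarrow> nat \<Rightarrow> bool) \<Rightarrow> (nat \<Rightarrow> nat \<Rightarrow> bool) \<Rightarrow> nat \<Rightarrow> 'b::comm_ring_1 fps" where
  "chain_sum A P Q n = word_sum A n (\<lambda>\<sigma>. of_bool (alternating P Q \<sigma>))"

lemma chain_sum_0 [simp]: "chain_sum A P Q 0 = 1"
  by (simp add: chain_sum_def word_sum_0)

section \<open>The functional equation of the composition series\<close>

lemma word_sum_recurrence:
  assumes "\<And>x y. P x y \<Longrightarrow> \<not> Q x y" and "n > 0"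
  shows "word_sum A n (\<lambda>\<sigma>. q ^ extrema P Q \<sigma>) =
    (\<Sum>k<(n + 1) div 2. (q - 1) ^ k * chain_sum A P Q (2 * k + 1) *
      word_sum A (n - (2 * k + 1)) (\<lambda>\<sigma>. q ^ extrema P Q \<sigma>))"
proof -
  have "word_sum A n (\<lambda>\<sigma>. q ^ extrema P Q \<sigma>) = word_sum A n (\<lambda>\<sigma>.
      \<Sum>k<(n + 1) div 2. (q - 1) ^ k *
      (of_bool (alternating P Q (take (2 * k + 1) \<sigma>)) * q ^ extrema P Q (drop (2 * k + 1) \<sigma>)))"
  proof (rule word_sum_cong)
    fix \<sigma> :: "nat list" assume "length \<sigma> = n"
    with \<open>n > 0\<close> have "\<sigma> \<noteq> []" by auto
    from cluster_expansion[of P Q, OF assms(1) this, of q] \<open>length \<sigma> = n\<close>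
    show "q ^ extrema P Q \<sigma> = (\<Sum>k<(n + 1) div 2. (q - 1) ^ k *
      (of_bool (alternating P Q (take (2 * k + 1) \<sigma>)) * q ^ extrema P Q (drop (2 * k + 1) \<sigma>)))"
      by simp
  qed
  also have "\<dots> = (\<Sum>k<(n + 1) div 2. (q - 1) ^ k * (chain_sum A P Q (2 * k + 1) *
      word_sum A (n - (2 * k + 1)) (\<lambda>\<sigma>. q ^ extrema P Q \<sigma>)))"
    unfolding word_sum_sum[symmetric] chain_sum_def word_sum_mult
  proof (intro sum.cong refl)
    fix k assume "k \<in> {..<(n + 1) div 2}"
    then have "2 * k + 1 + (n - (2 * k + 1)) = n" by auto
    then show "(q - 1) ^ k * word_sum A n (\<lambda>\<sigma>. of_bool (alternating P Q (take (2 * k + 1) \<sigma>)) *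
          q ^ extrema P Q (drop (2 * k + 1) \<sigma>)) =
        (q - 1) ^ k * word_sum A (2 * k + 1 + (n - (2 * k + 1)))
          (\<lambda>\<sigma>. of_bool (alternating P Q (take (2 * k + 1) \<sigma>)) *
            q ^ extrema P Q (drop (2 * k + 1) \<sigma>))"
      by simp
  qed
  finally show ?thesis by (simp only: mult.assoc)
qed

text \<open>Here the outer \<open>fps_X\<close> is \<open>z\<close>. A cluster with \<open>k\<close>
  marks has \<open>2 * k + 1\<close> letters, hence \<open>fps_X * (K oo fps_X ^ 2)\<close>; the
  summand 1 is the empty word.\<close>

lemma cluster_equation:
  fixes q :: "'b::idom fps" and A :: "nat set"
  assumes "\<And>x y. P x y \<Longrightarrow> \<not> Q x y"
  defines "C \<equiv> Abs_fps (\<lambda>n. word_sum A n (\<lambda>\<sigma>. q ^ extrema P Q \<sigma>))"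
  defines "K \<equiv> Abs_fps (\<lambda>k. (q - 1) ^ k * chain_sum A P Q (2 * k + 1))"
  shows "C = 1 + fps_X * (K oo fps_X ^ 2) * C"
proof (rule fps_ext)
  fix n
  show "C $ n = (1 + fps_X * (K oo fps_X ^ 2) * C) $ n"
  proof (cases n)
    case 0
    then show ?thesis by (simp add: C_def word_sum_0 extrema_short mult.assoc)
  next
    case (Suc m)
    \<comment> \<open>The factor \<open>fps_X\<close> lowers the degree from \<open>n\<close> to
      \<open>m\<close>; \<open>K oo fps_X ^ 2\<close> has even coefficients only.\<close>
    have "(\<Sum>i=0..m. (K oo fps_X ^ 2) $ i * C $ (m - i))
        = (\<Sum>i | i \<le> m \<and> even i. K $ (i div 2) * C $ (m - i))"
      by (rule sum.mono_neutral_cong_right) (auto simp: fps_nth_compose_X_power)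
    also have "\<dots> = (\<Sum>k<(n + 1) div 2. K $ k * C $ (m - 2 * k))"
      by (rule sum.reindex_bij_witness[of _ "\<lambda>k. 2 * k" "\<lambda>i. i div 2"]) (auto simp: Suc)
    also have "\<dots> = C $ n"
      unfolding C_def K_def using word_sum_recurrence[of P Q n A q] assms(1) Suc by simp
    finally show ?thesis
      by (simp add: Suc mult.assoc fps_mult_nth[of "K oo _"])
  qed
qed

section \<open>Products of cluster and chain series\<close>

text \<open>This is \<open>cluster_then_chain\<close> summed over words of length
  \<open>2 * j + 1\<close>; the weights \<open>- t\<close> in clusters and \<open>t\<close> in
  chains supply its signs. For \<open>(>)\<close>, \<open>(<)\<close> the even chains have steps
  \<open><\<close>, \<open>\<le>\<close> and the odd ones \<open>\<le>\<close>,
  \<open><\<close>.\<close>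

lemma cluster_quotient_valley:
  fixes t :: "'b::comm_ring_1 fps"
  shows "Abs_fps (\<lambda>k. (- t) ^ k * chain_sum A P Q (2 * k + 1)) *
      Abs_fps (\<lambda>k. t ^ k * chain_sum A Q (\<lambda>x y. \<not> P x y) (2 * k)) =
    Abs_fps (\<lambda>k. t ^ k * chain_sum A (\<lambda>x y. \<not> P x y) Q (2 * k + 1))"
proof (rule fps_ext)
  fix j
  have "(\<Sum>k\<le>j. (- t) ^ k * chain_sum A P Q (2 * k + 1) *
        (t ^ (j - k) * chain_sum A Q (\<lambda>x y. \<not> P x y) (2 * (j - k))))
      = t ^ j * (\<Sum>k\<le>j. (- 1) ^ k * (chain_sum A P Q (2 * k + 1) *
         chain_sum A Q (\<lambda>x y. \<not> P x y) (2 * (j - k))))"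
    unfolding sum_distrib_left
  proof (intro sum.cong refl)
    fix k assume "k \<in> {..j}"
    then have "t ^ j = t ^ k * t ^ (j - k)" by (simp flip: power_add)
    then show "(- t) ^ k * chain_sum A P Q (2 * k + 1) *
        (t ^ (j - k) * chain_sum A Q (\<lambda>x y. \<not> P x y) (2 * (j - k)))
      = t ^ j * ((- 1) ^ k * (chain_sum A P Q (2 * k + 1) *
         chain_sum A Q (\<lambda>x y. \<not> P x y) (2 * (j - k))))"
      unfolding power_minus[of t k] by (simp only: mult_ac)
  qed
  also have "(\<Sum>k\<le>j. (- 1) ^ k * (chain_sum A P Q (2 * k + 1) *
         chain_sum A Q (\<lambda>x y. \<not> P x y) (2 * (j - k))))
      = (\<Sum>k\<le>j. (- 1) ^ k * word_sum A (2 * j + 1) (\<lambda>\<sigma>.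
          of_bool (alternating P Q (take (2 * k + 1) \<sigma>)) *
          of_bool (alternating Q (\<lambda>x y. \<not> P x y) (drop (2 * k + 1) \<sigma>))))"
  proof (intro sum.cong refl arg_cong2[where f = "(*)"])
    fix k assume "k \<in> {..j}"
    then have "2 * k + 1 + 2 * (j - k) = 2 * j + 1" by auto
    then show "chain_sum A P Q (2 * k + 1) * chain_sum A Q (\<lambda>x y. \<not> P x y) (2 * (j - k)) =
        word_sum A (2 * j + 1) (\<lambda>\<sigma>. of_bool (alternating P Q (take (2 * k + 1) \<sigma>)) *
          of_bool (alternating Q (\<lambda>x y. \<not> P x y) (drop (2 * k + 1) \<sigma>)))"
      unfolding chain_sum_def word_sum_mult by simp
  qed
  also have "\<dots> = (chain_sum A (\<lambda>x y. \<not> P x y) Q (2 * j + 1) :: 'b fps)"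
    unfolding word_sum_sum chain_sum_def by (intro word_sum_cong cluster_then_chain)
  finally show "(Abs_fps (\<lambda>k. (- t) ^ k * chain_sum A P Q (2 * k + 1)) *
      Abs_fps (\<lambda>k. t ^ k * chain_sum A Q (\<lambda>x y. \<not> P x y) (2 * k))) $ j =
    Abs_fps (\<lambda>k. t ^ k * chain_sum A (\<lambda>x y. \<not> P x y) Q (2 * k + 1)) $ j"
    by (simp add: fps_mult_nth atLeast0AtMost)
qed

text \<open>The counterpart by \<open>chain_then_cluster\<close>; for \<open>(<)\<close>,
  \<open>(>)\<close> both chain families have steps \<open><\<close>, \<open>\<le>\<close>.\<close>

lemma cluster_quotient_peak:
  fixes t :: "'b::comm_ring_1 fps"
  shows "Abs_fps (\<lambda>k. (- t) ^ k * chain_sum A P Q (2 * k + 1)) *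
      Abs_fps (\<lambda>k. t ^ k * chain_sum A P (\<lambda>x y. \<not> Q x y) (2 * k)) =
    Abs_fps (\<lambda>k. t ^ k * chain_sum A P (\<lambda>x y. \<not> Q x y) (2 * k + 1))"
proof (rule fps_ext)
  fix j
  let ?R = "\<lambda>x y. \<not> Q x y"
  \<comment> \<open>Moves the sign onto the chain index and later absorbs the
    \<open>(- 1) ^ j\<close> left by the telescoping.\<close>
  have sign: "(- t) ^ k * (- 1) ^ k = t ^ k" for k
    unfolding power_mult_distrib[symmetric] by simp
  have "(\<Sum>k\<le>j. t ^ k * chain_sum A P ?R (2 * k) *
        ((- t) ^ (j - k) * chain_sum A P Q (2 * (j - k) + 1)))
      = (- t) ^ j * (\<Sum>k\<le>j. (- 1) ^ k * (chain_sum A P ?R (2 * k) *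
         chain_sum A P Q (2 * (j - k) + 1)))"
    unfolding sum_distrib_left
  proof (intro sum.cong refl)
    fix k assume "k \<in> {..j}"
    then have split: "(- t) ^ j = (- t) ^ k * (- t) ^ (j - k)" by (simp flip: power_add)
    show "t ^ k * chain_sum A P ?R (2 * k) *
        ((- t) ^ (j - k) * chain_sum A P Q (2 * (j - k) + 1))
      = (- t) ^ j * ((- 1) ^ k * (chain_sum A P ?R (2 * k) * chain_sum A P Q (2 * (j - k) + 1)))"
      unfolding sign[of k, symmetric] split by (simp only: mult_ac)
  qed
  also have "(\<Sum>k\<le>j. (- 1) ^ k * (chain_sum A P ?R (2 * k) * chain_sum A P Q (2 * (j - k) + 1)))
      = (\<Sum>k\<le>j. (- 1) ^ k * word_sum A (2 * j + 1) (\<lambda>\<sigma>.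
          of_bool (alternating P ?R (take (2 * k) \<sigma>)) *
          of_bool (alternating P Q (drop (2 * k) \<sigma>))))"
  proof (intro sum.cong refl arg_cong2[where f = "(*)"])
    fix k assume "k \<in> {..j}"
    then have "2 * k + (2 * (j - k) + 1) = 2 * j + 1" by auto
    then show "chain_sum A P ?R (2 * k) * chain_sum A P Q (2 * (j - k) + 1) =
        word_sum A (2 * j + 1) (\<lambda>\<sigma>. of_bool (alternating P ?R (take (2 * k) \<sigma>)) *
          of_bool (alternating P Q (drop (2 * k) \<sigma>)))"
      unfolding chain_sum_def word_sum_mult by simp
  qed
  also have "\<dots> = ((- 1) ^ j * chain_sum A P ?R (2 * j + 1) :: 'b fps)"
    unfolding word_sum_sum unfolding chain_sum_def word_sum_mult_left
    by (intro word_sum_cong chain_then_cluster)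
  also have "(- t) ^ j * ((- 1) ^ j * chain_sum A P ?R (2 * j + 1)) =
      t ^ j * chain_sum A P ?R (2 * j + 1)"
    unfolding mult.assoc[symmetric] sign ..
  finally have "(\<Sum>k\<le>j. t ^ k * chain_sum A P ?R (2 * k) *
        ((- t) ^ (j - k) * chain_sum A P Q (2 * (j - k) + 1)))
      = t ^ j * chain_sum A P ?R (2 * j + 1)" .
  then show "(Abs_fps (\<lambda>k. (- t) ^ k * chain_sum A P Q (2 * k + 1)) *
      Abs_fps (\<lambda>k. t ^ k * chain_sum A P ?R (2 * k))) $ j =
    Abs_fps (\<lambda>k. t ^ k * chain_sum A P ?R (2 * k + 1)) $ j"
    \<comment> \<open>After commuting, the convolution index counts the chain, which stands first in
      the word.\<close>
    by (subst mult.commute) (simp add: fps_mult_nth atLeast0AtMost)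
qed

section \<open>Infinite sums in the \<open>z\<close>-adic topology\<close>

lemma fps_const_mult_X_power_nth:
  "(fps_const c * fps_X ^ k) $ n = (if n = k then c else 0 :: 'b::comm_ring_1)"
  by simp

text \<open>Coefficient \<open>n\<close> of the partial sums is final once \<open>N > n\<close>. The
  sum starts at exponent 2, hence the subtracted constant term.\<close>

lemma suminf_fps_X_even:
  "(\<Sum>j. fps_const (f (Suc j)) * fps_X ^ (2 * Suc j)) =
    (Abs_fps f oo fps_X ^ 2) - fps_const (f 0 :: 'b::idom)"
proof (rule sums_unique[symmetric], unfold sums_def, rule tendsto_fpsI)
  fix n
  show "\<forall>\<^sub>F N in sequentially. (\<Sum>j<N. fps_const (f (Suc j)) * fps_X ^ (2 * Suc j)) $ n =
    ((Abs_fps f oo fps_X ^ 2) - fps_const (f 0)) $ n"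
  proof (rule eventually_mono[OF eventually_gt_at_top[of n]])
    fix N assume "n < N"
    then have "n div 2 < N" "n div 2 - 1 < N" by auto
    \<comment> \<open>For \<open>n = 0\<close> truncated subtraction gives \<open>j = 0\<close>,
      hence the guard \<open>n > 0\<close>.\<close>
    have "(\<Sum>j<N. if n = 2 * Suc j then f (Suc j) else 0)
        = (\<Sum>j<N. if j = n div 2 - 1 then (if even n \<and> n > 0 then f (n div 2) else 0) else 0)"
      by (intro sum.cong refl) (auto elim!: evenE)
    also have "\<dots> = (if even n \<and> n > 0 then f (n div 2) else 0)"
      using \<open>n div 2 < N\<close> \<open>n div 2 - 1 < N\<close> by simp
    finally show "(\<Sum>j<N. fps_const (f (Suc j)) * fps_X ^ (2 * Suc j)) $ n =
      ((Abs_fps f oo fps_X ^ 2) - fps_const (f 0)) $ n"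
      unfolding fps_sum_nth fps_const_mult_X_power_nth by (auto simp: fps_nth_compose_X_power)
  qed
qed

lemma suminf_fps_X_odd:
  "(\<Sum>j. fps_const (f j) * fps_X ^ (2 * j + 1)) =
    fps_X * (Abs_fps (f :: nat \<Rightarrow> 'b::idom) oo fps_X ^ 2)"
proof (rule sums_unique[symmetric], unfold sums_def, rule tendsto_fpsI)
  fix n
  show "\<forall>\<^sub>F N in sequentially. (\<Sum>j<N. fps_const (f j) * fps_X ^ (2 * j + 1)) $ n =
    (fps_X * (Abs_fps f oo fps_X ^ 2)) $ n"
  proof (rule eventually_mono[OF eventually_gt_at_top[of n]])
    fix N assume "n < N"
    then have "n div 2 < N" "n div 2 - 1 < N" by auto
    have "(\<Sum>j<N. if n = 2 * j + 1 then f j else 0)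
        = (\<Sum>j<N. if j = n div 2 then (if odd n then f (n div 2) else 0) else 0)"
      by (intro sum.cong refl) (auto elim!: oddE)
    also have "\<dots> = (if odd n then f (n div 2) else 0)"
      using \<open>n div 2 < N\<close> \<open>n div 2 - 1 < N\<close> by simp
    finally show "(\<Sum>j<N. fps_const (f j) * fps_X ^ (2 * j + 1)) $ n =
      (fps_X * (Abs_fps f oo fps_X ^ 2)) $ n"
      unfolding fps_sum_nth fps_const_mult_X_power_nth
      by (cases n) (auto simp: fps_nth_compose_X_power)
  qed
qed

section \<open>From index tuples to words\<close>

text \<open>Injectivity of \<open>a\<close> lets \<open>inv_into\<close> recover a tuple from its
  word. Tuples are indexed from 1 and lists from 0, hence \<open>Suc\<close> and
  \<open>j - 1\<close>.\<close>

lemma sum_tuples_eq_sum_words: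
  fixes d s :: nat
  assumes "inj_on a {1..d}"
  shows "(\<Sum>i\<in>{1..s} \<rightarrow>\<^sub>E {1..d}. F (map (\<lambda>j. a (i (Suc j))) [0..<s])) =
    (\<Sum>\<sigma> | set \<sigma> \<subseteq> a ` {1..d} \<and> length \<sigma> = s. F \<sigma>)"
proof (rule sum.reindex_bij_witness[of _
      "\<lambda>\<sigma>. \<lambda>j\<in>{1..s}. inv_into {1..d} a (\<sigma> ! (j - 1))" "\<lambda>i. map (\<lambda>j. a (i (Suc j))) [0..<s]"])
  fix i assume i: "i \<in> {1..s} \<rightarrow>\<^sub>E {1..d}"
  show "(\<lambda>j\<in>{1..s}. inv_into {1..d} a (map (\<lambda>j. a (i (Suc j))) [0..<s] ! (j - 1))) = i"
  proof (rule ext)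
    fix j
    show "(\<lambda>j\<in>{1..s}. inv_into {1..d} a (map (\<lambda>j. a (i (Suc j))) [0..<s] ! (j - 1))) j = i j"
    proof (cases "j \<in> {1..s}")
      case True
      then have "map (\<lambda>j. a (i (Suc j))) [0..<s] ! (j - 1) = a (i j)"
        by (cases j) auto
      then show ?thesis
        using True inv_into_f_f[OF assms PiE_mem[OF i True]] by simp
    next
      case False
      then show ?thesis
        unfolding PiE_arb[OF i False] by (simp only: restrict_def if_False)
    qed
  qed
  show "map (\<lambda>j. a (i (Suc j))) [0..<s] \<in> {\<sigma>. set \<sigma> \<subseteq> a ` {1..d} \<and> length \<sigma> = s}"
  proof (clarsimp, rule imageI)
    fix j assume "j < s"
    then show "i (Suc j) \<in> {Suc 0..d}"
      using PiE_mem[OF i, of "Suc j"] by simp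
  qed
next
  fix \<sigma> assume \<sigma>: "\<sigma> \<in> {\<sigma>. set \<sigma> \<subseteq> a ` {1..d} \<and> length \<sigma> = s}"
  then have mem: "\<sigma> ! j \<in> a ` {1..d}" if "j < s" for j
    using that nth_mem by blast
  show "map (\<lambda>j. a ((\<lambda>j\<in>{1..s}. inv_into {1..d} a (\<sigma> ! (j - 1))) (Suc j))) [0..<s] = \<sigma>"
    using \<sigma> by (intro nth_equalityI) (simp_all add: f_inv_into_f[OF mem, simplified])
  show "(\<lambda>j\<in>{1..s}. inv_into {1..d} a (\<sigma> ! (j - 1))) \<in> {1..s} \<rightarrow>\<^sub>E {1..d}"
  proof (intro restrict_PiE_iff[THEN iffD2] ballI inv_into_into)
    fix j assume "j \<in> {1..s}"
    then show "\<sigma> ! (j - 1) \<in> a ` {1..d}"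
      using mem[of "j - 1"] by auto
  qed
qed simp

lemma sum_tuples_eq_chain_sum:
  fixes a :: "nat \<Rightarrow> nat"
  assumes "inj_on a {1..d}"
    and "\<And>i. i \<in> {1..s} \<rightarrow>\<^sub>E {1..d} \<Longrightarrow>
      T i \<longleftrightarrow> alternating P Q (map (\<lambda>j. a (i (Suc j))) [0..<s])"
  shows "(\<Sum>i\<in>{i \<in> {1..s} \<rightarrow>\<^sub>E {1..d}. T i}. gf_z ^ s * (\<Prod>j=1..s. gf_x ^ a (i j))) =
    fps_const (chain_sum (a ` {1..d}) P Q s) * fps_X ^ s"
proof -
  let ?W = "\<lambda>i. map (\<lambda>j. a (i (Suc j))) [0..<s]"
  have prod: "(\<Prod>j=1..s. gf_x ^ a (i j)) = fps_const (fps_X ^ sum_list (?W i))" for i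
  proof -
    have "(\<Sum>j=1..s. a (i j)) = (\<Sum>j<s. a (i (Suc j)))"
      using sum.shift_bounds_Suc_ivl[of "\<lambda>j. a (i j)" 0 s]
      by (simp add: atLeast0LessThan atLeastLessThanSuc_atLeastAtMost)
    also have "\<dots> = sum_list (?W i)"
      by (simp add: interv_sum_list_conv_sum_set_nat atLeast0LessThan)
    finally show ?thesis
      by (simp only: gf_x_def power_sum[symmetric] flip: fps_const_power)
  qed
  have "(\<Sum>i\<in>{i \<in> {1..s} \<rightarrow>\<^sub>E {1..d}. T i}. gf_z ^ s * (\<Prod>j=1..s. gf_x ^ a (i j)))
      = (\<Sum>i\<in>{1..s} \<rightarrow>\<^sub>E {1..d}. fps_const (fps_X ^ sum_list (?W i) *
          of_bool (alternating P Q (?W i))) * fps_X ^ s)"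
    unfolding prod gf_z_def
    by (rule sum.mono_neutral_cong_left) (auto simp: assms(2) finite_PiE mult.commute)
  also have "\<dots> = (\<Sum>\<sigma> | set \<sigma> \<subseteq> a ` {1..d} \<and> length \<sigma> = s.
      fps_const (fps_X ^ sum_list \<sigma> * of_bool (alternating P Q \<sigma>)) * fps_X ^ s)"
    by (rule sum_tuples_eq_sum_words[OF assms(1)])
  also have "\<dots> = fps_const (chain_sum (a ` {1..d}) P Q s) * fps_X ^ s"
    unfolding chain_sum_def word_sum_def sum_distrib_right[symmetric]
    by (rule arg_cong[where f = "\<lambda>c. c * _"], rule fps_ext) (simp add: fps_sum_nth)
  finally show ?thesis .
qed

lemma alternating_tuple_iff:
  "alternating P Q (map (\<lambda>j. f (Suc j)) [0..<s]) \<longleftrightarrow>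
    (\<forall>l\<ge>1. 2 * l \<le> s \<longrightarrow> P (f (2 * l - 1)) (f (2 * l))) \<and>
    (\<forall>l\<ge>1. 2 * l + 1 \<le> s \<longrightarrow> Q (f (2 * l)) (f (2 * l + 1)))"
  (is "?L \<longleftrightarrow> ?E \<and> ?O")
proof -
  have shift: "(\<forall>l\<ge>1. R l) \<longleftrightarrow> (\<forall>k. R (Suc k))" for R :: "nat \<Rightarrow> bool"
    by (metis Suc_le_D One_nat_def le_add1 plus_1_eq_Suc)
  have parity: "(\<forall>i. R i) \<longleftrightarrow> (\<forall>k. R (2 * k)) \<and> (\<forall>k. R (2 * k + 1))" for R :: "nat \<Rightarrow> bool"
    by (metis oddE evenE)
  have "?L \<longleftrightarrow> (\<forall>i. Suc i < s \<longrightarrow> (if even i then P else Q) (f (Suc i)) (f (Suc (Suc i))))"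
    by (simp add: alternating_iff_nth)
  also have "\<dots> \<longleftrightarrow> ?E \<and> ?O"
    \<comment> \<open>Position \<open>2 * k\<close> is the step from \<open>f (2 * l - 1)\<close>
      and position \<open>2 * k + 1\<close> the step from \<open>f (2 * l)\<close>, both with
      \<open>l = Suc k\<close>.\<close>
    unfolding shift by (subst parity) (simp add: Suc_le_eq)
  finally show ?thesis .
qed

text \<open>Strict monotonicity carries comparisons of indices over to parts. The weak inequality
  appears as a negated \<open><\<close>, the form in which the cluster products yield it.\<close>

lemma M_sum_eq_chain_sum:
  assumes "strict_mono_on {1..d} a"
  shows "M_sum a d s = fps_const (chain_sum (a ` {1..d}) (<) (\<lambda>x y. \<not> y < x) s) * fps_X ^ s"
  unfolding M_sum_def P_tuples_def
proof (rule sum_tuples_eq_chain_sum)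
  show "inj_on a {1..d}"
    using assms by (rule strict_mono_on_imp_inj_on)
  fix i :: "nat \<Rightarrow> nat" assume i: "i \<in> {1..s} \<rightarrow>\<^sub>E {1..d}"
  have less: "a (i j) < a (i k) \<longleftrightarrow> i j < i k" if "j \<in> {1..s}" "k \<in> {1..s}" for j k
    using strict_mono_on_less[OF assms] PiE_mem[OF i] that by blast
  show "((\<forall>l\<ge>1. 2 * l \<le> s \<longrightarrow> i (2 * l - 1) < i (2 * l)) \<and>
      (\<forall>l\<ge>1. 2 * l + 1 \<le> s \<longrightarrow> i (2 * l) \<le> i (2 * l + 1))) \<longleftrightarrow>
    alternating (<) (\<lambda>x y. \<not> y < x) (map (\<lambda>j. a (i (Suc j))) [0..<s])"
    unfolding alternating_tuple_iff[where f = "\<lambda>j. a (i j)"]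
    by (intro conj_cong all_cong1 imp_cong refl) (simp_all add: less not_less[symmetric])
qed

lemma N_sum_eq_chain_sum:
  assumes "strict_mono_on {1..d} a"
  shows "N_sum a d s = fps_const (chain_sum (a ` {1..d}) (\<lambda>x y. \<not> y < x) (<) s) * fps_X ^ s"
  unfolding N_sum_def Q_tuples_def
proof (rule sum_tuples_eq_chain_sum)
  show "inj_on a {1..d}"
    using assms by (rule strict_mono_on_imp_inj_on)
  fix i :: "nat \<Rightarrow> nat" assume i: "i \<in> {1..s} \<rightarrow>\<^sub>E {1..d}"
  have less: "a (i j) < a (i k) \<longleftrightarrow> i j < i k" if "j \<in> {1..s}" "k \<in> {1..s}" for j k
    using strict_mono_on_less[OF assms] PiE_mem[OF i] that by blast
  show "((\<forall>l\<ge>1. 2 * l \<le> s \<longrightarrow> i (2 * l - 1) \<le> i (2 * l)) \<and>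
      (\<forall>l\<ge>1. 2 * l + 1 \<le> s \<longrightarrow> i (2 * l) < i (2 * l + 1))) \<longleftrightarrow>
    alternating (\<lambda>x y. \<not> y < x) (<) (map (\<lambda>j. a (i (Suc j))) [0..<s])"
    unfolding alternating_tuple_iff[where f = "\<lambda>j. a (i j)"]
    by (intro conj_cong all_cong1 imp_cong refl) (simp_all add: less not_less[symmetric])
qed

section \<open>The quotient formulas\<close>

lemma composition_gf_extrema:
  assumes "finite A"
  shows "composition_gf A (extrema P Q) =
    Abs_fps (\<lambda>n. word_sum A n (\<lambda>\<sigma>. fps_const fps_X ^ extrema P Q \<sigma>))"
proof (rule fps_ext)
  fix n
  show "composition_gf A (extrema P Q) $ n =
    Abs_fps (\<lambda>n. word_sum A n (\<lambda>\<sigma>. fps_const fps_X ^ extrema P Q \<sigma>)) $ n"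
    by (simp add: composition_gf_nth[OF assms] word_sum_def compositions_def lists_eq_set)
qed

text \<open>With \<open>F\<close>, \<open>G\<close>, \<open>K\<close> taken at \<open>z^2\<close>,
  \<open>C = 1 + z K C\<close> and \<open>K F = G\<close> give
  \<open>C (F - z G) = (C - z K C) F = F\<close>. The denominator has constant term 1, so the
  division is exact.\<close>

lemma composition_gf_extrema_quotient:
  fixes F G :: gf
  assumes "finite A" and "\<And>x y. P x y \<Longrightarrow> \<not> Q x y" and "F $ 0 = 1"
    and "Abs_fps (\<lambda>k. (- (1 - fps_const fps_X)) ^ k * chain_sum A P Q (2 * k + 1)) * F = G"
  shows "composition_gf A (extrema P Q) =
    (F oo fps_X ^ 2) / ((F oo fps_X ^ 2) - fps_X * (G oo fps_X ^ 2))"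
proof -
  let ?C = "composition_gf A (extrema P Q)"
  let ?K = "Abs_fps (\<lambda>k. (- (1 - fps_const fps_X)) ^ k * chain_sum A P Q (2 * k + 1)) :: gf"
  have C: "?C = 1 + fps_X * (?K oo fps_X ^ 2) * ?C"
    using cluster_equation[of P Q A "fps_const fps_X"] assms(2)
    by (simp add: composition_gf_extrema[OF assms(1)])
  have "G oo fps_X ^ 2 = (?K oo fps_X ^ 2) * (F oo fps_X ^ 2)"
    unfolding assms(4)[symmetric] by (rule fps_compose_mult_distrib) simp
  then have "?C * ((F oo fps_X ^ 2) - fps_X * (G oo fps_X ^ 2))
      = (?C - fps_X * (?K oo fps_X ^ 2) * ?C) * (F oo fps_X ^ 2)"
    by (simp only: algebra_simps)
  also have "?C - fps_X * (?K oo fps_X ^ 2) * ?C = 1"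
    using C by (simp only: diff_eq_eq)
  finally show ?thesis
    using assms(3) by (subst gf_divide_eq_iff) simp_all
qed

theorem theorem4:
  fixes a :: "nat \<Rightarrow> nat" and d :: nat and A :: "nat set"
  assumes "A = a ` {1..d}"
    and "strict_mono_on {1..d} a"
    and "\<forall>i\<in>{1..d}. 0 < a i"
  shows "C_peak A =
      (1 + (\<Sum>j. M_sum a d (2 * Suc j) * (1 - gf_y) ^ Suc j)) /
      (1 + (\<Sum>j. M_sum a d (2 * Suc j) * (1 - gf_y) ^ Suc j)
         - (\<Sum>j. M_sum a d (2 * j + 1) * (1 - gf_y) ^ j))
    \<and> C_valley A =
      (1 + (\<Sum>j. M_sum a d (2 * Suc j) * (1 - gf_y) ^ Suc j)) /
      (1 + (\<Sum>j. M_sum a d (2 * Suc j) * (1 - gf_y) ^ Suc j)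
         - (\<Sum>j. N_sum a d (2 * j + 1) * (1 - gf_y) ^ j))"
proof -
  let ?t = "1 - fps_const fps_X :: rat fps fps"
  let ?le = "\<lambda>x y :: nat. \<not> y < x"
  let ?E = "Abs_fps (\<lambda>k. ?t ^ k * chain_sum A (<) ?le (2 * k))"
  let ?M = "Abs_fps (\<lambda>k. ?t ^ k * chain_sum A (<) ?le (2 * k + 1))"
  let ?N = "Abs_fps (\<lambda>k. ?t ^ k * chain_sum A ?le (<) (2 * k + 1))"
  have fin: "finite A"
    using assms(1) by simp
  have t: "(1 - gf_y) ^ k = fps_const (?t ^ k)" for k
    by (simp add: gf_y_def flip: fps_const_power fps_const_sub)
  have mult_t: "fps_const c * fps_X ^ s * fps_const u = fps_const (u * c) * fps_X ^ s"
    for c u :: "rat fps fps" and s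
    by (simp add: mult_ac flip: fps_const_mult)
  have even: "1 + (\<Sum>j. M_sum a d (2 * Suc j) * (1 - gf_y) ^ Suc j) = ?E oo fps_X ^ 2"
    unfolding M_sum_eq_chain_sum[OF assms(2)] t mult_t assms(1)[symmetric]
    \<comment> \<open>The leading 1 is the missing coefficient for \<open>k = 0\<close>, by
      \<open>chain_sum_0\<close>.\<close>
    by (subst suminf_fps_X_even[of "\<lambda>k. ?t ^ k * chain_sum A (<) ?le (2 * k)"]) simp
  have odd_M: "(\<Sum>j. M_sum a d (2 * j + 1) * (1 - gf_y) ^ j) = fps_X * (?M oo fps_X ^ 2)"
    unfolding M_sum_eq_chain_sum[OF assms(2)] t mult_t assms(1)[symmetric]
    by (rule suminf_fps_X_odd)
  have odd_N: "(\<Sum>j. N_sum a d (2 * j + 1) * (1 - gf_y) ^ j) = fps_X * (?N oo fps_X ^ 2)"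
    unfolding N_sum_eq_chain_sum[OF assms(2)] t mult_t assms(1)[symmetric]
    by (rule suminf_fps_X_odd)
  have "C_peak A = composition_gf A (extrema (<) (>))"
    unfolding C_peak_def peaks_def extrema_def ..
  also have "\<dots> = (?E oo fps_X ^ 2) / ((?E oo fps_X ^ 2) - fps_X * (?M oo fps_X ^ 2))"
    by (rule composition_gf_extrema_quotient[OF fin _ _ cluster_quotient_peak]) auto
  finally have peak: "C_peak A = \<dots>" .
  have "C_valley A = composition_gf A (extrema (>) (<))"
    unfolding C_valley_def valleys_def extrema_def ..
  also have "\<dots> = (?E oo fps_X ^ 2) / ((?E oo fps_X ^ 2) - fps_X * (?N oo fps_X ^ 2))"
    \<comment> \<open>Now the first relation \<open>(>)\<close> is negated instead of the second:
      the even chains again have steps \<open><\<close>, \<open>\<le>\<close>, which keeps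
      \<open>?E\<close>, but the odd ones start with \<open>\<le>\<close>, which gives
      \<open>?N\<close>.\<close>
    by (rule composition_gf_extrema_quotient[OF fin _ _ cluster_quotient_valley]) auto
  finally have valley: "C_valley A = \<dots>" .
  show ?thesis
    unfolding even odd_M odd_N using peak valley by blast
qed

end
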